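(* Let $f_0:\mathbb{N}\to[0,\infty)$ satisfy $m_\kappa\langle f_0\rangle<\infty$ for a fixed $\kappa>\max\{\delta,1,2-\alpha_1-\beta_1\}$, and let $f(t)$ be the solution of the discrete equation $\frac{\partial f}{\partial t}=O[f]$ with initial data $f_0$, where the discretization mesh size is $h>0$. Then, for all $t\ge0$, $$m_1\langle f(t)\rangle\le e^{-h^\delta t}\,m_1\langle f_0\rangle.$$
   Context: $\mathbb{N}=\{1,2,3,\dots\}$. Fix a mesh size $h>0$ and positive real parameters $\alpha_n,\beta_n$ ($n\in\{1,2,3\}$) and $\delta$ with $\delta>\max_{n\in\{1,2,3\}}(\alpha_n+\beta_n)$ and $\delta>2\alpha_1+\beta_1-1$. For $x,y\ge 0$ let $K_n(x,y)=x^{\alpha_n}y^{\alpha_n}(x+y)^{\beta_n}$ and $\gamma(x)=x^\delta$. For $f:\mathbb{N}\to\mathbb{R}$ and $i\in\mathbb{N}$ set $$S^{(1)}_i[f]=\sum_{j=1}^{i-1}K_1(jh,(i-j)h)f_jf_{i-j}-2\sum_{j=1}^\infty K_1(ih,jh)f_if_j,$$ and for $n\in\{2,3\}$ $$S^{(n)}_i[f]=-\sum_{j=1}^{i-1}K_n((i-j)h,jh)f_if_j+\sum_{j=i+1}^\infty K_n((j-i)h,ih)f_if_j+\sum_{j=i+1}^\infty K_n(ih,(j-i)h)f_jf_{j-i},$$ $V_i[f]=\gamma(ih)f_i$, $S[f]=S^{(1)}[f]+S^{(2)}[f]+S^{(3)}[f]$, and $O[f]=S[f]-V[f]$. The moments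 are $m_k\langle f\rangle=\sum_{i=1}^\infty f_i\,(ih)^k$, $k\ge 0$. For $k>\max\{1,2-\alpha_1-\beta_1\}$ and $x\ge0$ define $$\mathcal{B}_k(x)=\Bigl(2\,\mathcal{C}_k\,x^{1+\frac{\delta+k-1}{\delta-2\alpha_1-\beta_1+1}+\frac{\delta}{k-1}}\Bigr)^{\frac{k-1}{\delta+k-1}},$$ where $\mathcal{C}_k$ is the positive constant $$\mathcal{C}_k=\frac{\delta-2\alpha_1-\beta_1+1}{\delta+k-1}\bigl[2^{\beta_1+1}(2^k-2)\bigr]^{\frac{\delta+k-1}{\delta-2\alpha_1-\beta_1+1}}\Bigl(\frac{2(2\alpha_1+\beta_1+k-2)}{\delta+k-1}\Bigr)^{\frac{2\alpha_1+\beta_1+k-2}{\delta-2\alpha_1-\beta_1+1}}.$$ "The solution" with initial datum $f_0$ means the global classical solution $f\in C^1([0,\infty);\ell^1(\mathbb{N}))$ of $\frac{\partial f}{\partial t}=O[f]$, $f(0)=f_0$, which for all $t\ge0$ satisfies $f(t,i)\ge0$, $m_1\langle f(t)\rangle\le m_1\langle f_0\rangle$ and $m_\kappa\langle f(t)\rangle\le\max\{m_\kappa\langle f_0\rangle,2\mathcal{B}_\kappa(m_1\langle f_0\rangle)\}$ (the paper's well-posedness theorem gives existence and uniqueness). *)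

theory Defs
  imports "HOL-Analysis.Analysis"
begin

section \<open>The sequence space $\ell^1(\mathbb{N})$, $\mathbb{N} = \{1,2,3,\dots\}$\<close>

text \<open>Sequences are functions on \<^typ>\<open>nat\<close>; since the index set starts at 1, the unused
  entry at 0 is fixed to be 0, so that the norm separates points.\<close>

lemma ell1_summable_add:
  fixes u v :: "nat \<Rightarrow> real"
  assumes "(\<lambda>i. \<bar>u i\<bar>) summable_on A" "(\<lambda>i. \<bar>v i\<bar>) summable_on A"
  shows "(\<lambda>i. \<bar>u i + v i\<bar>) summable_on A"
proof (rule summable_on_comparison_test)
  show "(\<lambda>i. \<bar>u i\<bar> + \<bar>v i\<bar>) summable_on A"
    using assms by (rule summable_on_add)
qed auto

typedef ell1 = "{u :: nat \<Rightarrow> real. u 0 = 0 \<and> (\<lambda>i. \<bar>u i\<bar>) summable_on {1..}}"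
  morphisms ell1_nth Abs_ell1
  by (rule exI[of _ "\<lambda>_. 0"]) simp

setup_lifting type_definition_ell1

instantiation ell1 :: real_vector
begin

lift_definition zero_ell1 :: ell1 is "\<lambda>_. 0"
  by simp

lift_definition plus_ell1 :: "ell1 \<Rightarrow> ell1 \<Rightarrow> ell1" is "\<lambda>u v i. u i + v i"
  using ell1_summable_add by auto

lift_definition uminus_ell1 :: "ell1 \<Rightarrow> ell1" is "\<lambda>u i. - u i"
  by simp

lift_definition minus_ell1 :: "ell1 \<Rightarrow> ell1 \<Rightarrow> ell1" is "\<lambda>u v i. u i - v i"
  subgoal for u v
    using ell1_summable_add[of u "{1..}" "\<lambda>i. - v i"] by simp
  done

lift_definition scaleR_ell1 :: "real \<Rightarrow> ell1 \<Rightarrow> ell1" is "\<lambda>c u i. c * u i"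
  by (auto simp: abs_mult intro: summable_on_cmult_right)

instance
  by standard (transfer; simp add: fun_eq_iff algebra_simps)+

end

instantiation ell1 :: real_normed_vector
begin

lift_definition norm_ell1 :: "ell1 \<Rightarrow> real" is "\<lambda>u. \<Sum>\<^sub>\<infinity>i\<in>{1..}. \<bar>u i\<bar>" .

definition dist_ell1 :: "ell1 \<Rightarrow> ell1 \<Rightarrow> real"
  where "dist_ell1 u v = norm (u - v)"

definition sgn_ell1 :: "ell1 \<Rightarrow> ell1"
  where "sgn_ell1 u = inverse (norm u) *\<^sub>R u"

definition uniformity_ell1 :: "(ell1 \<times> ell1) filter"
  where "uniformity_ell1 = (INF e\<in>{0<..}. principal {(u, v). dist u v < e})"

definition open_ell1 :: "ell1 set \<Rightarrow> bool"
  where "open_ell1 U \<longleftrightarrow> (\<forall>u\<in>U. \<forall>\<^sub>F (u', v) in uniformity. u' = u \<longrightarrow> v \<in> U)"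

instance
proof
  fix u v :: ell1 and c :: real
  show "norm u = 0 \<longleftrightarrow> u = 0"
  proof transfer
    fix u :: "nat \<Rightarrow> real"
    assume u: "u 0 = 0 \<and> (\<lambda>i. \<bar>u i\<bar>) summable_on {1..}"
    show "((\<Sum>\<^sub>\<infinity>i\<in>{1..}. \<bar>u i\<bar>) = 0) = (u = (\<lambda>_. 0))"
    proof
      assume *: "(\<Sum>\<^sub>\<infinity>i\<in>{1..}. \<bar>u i\<bar>) = 0"
      have "u i = 0" for i
      proof (cases "i = 0")
        case False
        hence "\<bar>u i\<bar> = 0"
          using nonneg_infsum_le_0D[of "\<lambda>i. \<bar>u i\<bar>" "{1..}" i] * u by simp
        thus ?thesis by simp
      qed (use u in simp)
      thus "u = (\<lambda>_. 0)" by auto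
    qed simp
  qed
  show "norm (u + v) \<le> norm u + norm v"
  proof transfer
    fix u v :: "nat \<Rightarrow> real"
    assume u: "u 0 = 0 \<and> (\<lambda>i. \<bar>u i\<bar>) summable_on {1..}" and v: "v 0 = 0 \<and> (\<lambda>i. \<bar>v i\<bar>) summable_on {1..}"
    have "(\<Sum>\<^sub>\<infinity>i\<in>{1..}. \<bar>u i + v i\<bar>) \<le> (\<Sum>\<^sub>\<infinity>i\<in>{1..}. \<bar>u i\<bar> + \<bar>v i\<bar>)"
      using u v ell1_summable_add[of u "{1..}" v]
      by (intro infsum_mono summable_on_add) auto
    also have "\<dots> = (\<Sum>\<^sub>\<infinity>i\<in>{1..}. \<bar>u i\<bar>) + (\<Sum>\<^sub>\<infinity>i\<in>{1..}. \<bar>v i\<bar>)"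
      using u v by (intro infsum_add) auto
    finally show "(\<Sum>\<^sub>\<infinity>i\<in>{1..}. \<bar>u i + v i\<bar>) \<le> (\<Sum>\<^sub>\<infinity>i\<in>{1..}. \<bar>u i\<bar>) + (\<Sum>\<^sub>\<infinity>i\<in>{1..}. \<bar>v i\<bar>)" .
  qed
  show "norm (c *\<^sub>R u) = \<bar>c\<bar> * norm u"
    by transfer (simp add: abs_mult infsum_cmult_right')
qed (simp_all add: dist_ell1_def sgn_ell1_def uniformity_ell1_def open_ell1_def)

end


section \<open>The discrete equation\<close>

text \<open>Throughout, only the values \<open>f i\<close> with \<open>i \<ge> 1\<close> of a sequence are used.  Infinite sums are
  (unconditional) \<^const>\<open>infsum\<close>, which is 0 for a non-summable family; for a nonnegative sequence
  with a finite moment of order greater than \<open>\<alpha> n + \<beta> n\<close> all sums below converge.\<close>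

definition kernel :: "real \<Rightarrow> real \<Rightarrow> real \<Rightarrow> real \<Rightarrow> real"
  where "kernel a b x y = x powr a * y powr a * (x + y) powr b"

definition coag_op :: "real \<Rightarrow> real \<Rightarrow> real \<Rightarrow> (nat \<Rightarrow> real) \<Rightarrow> nat \<Rightarrow> real"
  where "coag_op h a b f i =
    (\<Sum>j = 1..<i. kernel a b (real j * h) (real (i - j) * h) * f j * f (i - j))
    - 2 * (\<Sum>\<^sub>\<infinity>j\<in>{1..}. kernel a b (real i * h) (real j * h) * f i * f j)"

definition frag_op :: "real \<Rightarrow> real \<Rightarrow> real \<Rightarrow> (nat \<Rightarrow> real) \<Rightarrow> nat \<Rightarrow> real"
  where "frag_op h a b f i =
    - (\<Sum>j = 1..<i. kernel a b (real (i - j) * h) (real j * h) * f i * f j)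
    + (\<Sum>\<^sub>\<infinity>j\<in>{i+1..}. kernel a b (real (j - i) * h) (real i * h) * f i * f j)
    + (\<Sum>\<^sub>\<infinity>j\<in>{i+1..}. kernel a b (real i * h) (real (j - i) * h) * f j * f (j - i))"

text \<open>The parameters \<open>\<alpha> n\<close>, \<open>\<beta> n\<close> matter only for \<open>n \<in> {1, 2, 3}\<close>.\<close>

definition S_op :: "real \<Rightarrow> (nat \<Rightarrow> real) \<Rightarrow> (nat \<Rightarrow> real) \<Rightarrow> (nat \<Rightarrow> real) \<Rightarrow> nat \<Rightarrow> real"
  where "S_op h \<alpha> \<beta> f i =
    coag_op h (\<alpha> 1) (\<beta> 1) f i + frag_op h (\<alpha> 2) (\<beta> 2) f i + frag_op h (\<alpha> 3) (\<beta> 3) f i"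

definition V_op :: "real \<Rightarrow> real \<Rightarrow> (nat \<Rightarrow> real) \<Rightarrow> nat \<Rightarrow> real"
  where "V_op h \<delta> f i = (real i * h) powr \<delta> * f i"

definition O_op ::
    "real \<Rightarrow> (nat \<Rightarrow> real) \<Rightarrow> (nat \<Rightarrow> real) \<Rightarrow> real \<Rightarrow> (nat \<Rightarrow> real) \<Rightarrow> nat \<Rightarrow> real"
  where "O_op h \<alpha> \<beta> \<delta> f i = S_op h \<alpha> \<beta> f i - V_op h \<delta> f i"

definition moment :: "real \<Rightarrow> real \<Rightarrow> (nat \<Rightarrow> real) \<Rightarrow> real"
  where "moment h k f = (\<Sum>\<^sub>\<infinity>i\<in>{1..}. f i * (real i * h) powr k)"

text \<open>For nonnegative \<open>f\<close> this says that the moment is finite (the real-valued \<^const>\<open>moment\<close>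
  is 0 if the series diverges).\<close>

definition finite_moment :: "real \<Rightarrow> real \<Rightarrow> (nat \<Rightarrow> real) \<Rightarrow> bool"
  where "finite_moment h k f \<longleftrightarrow> (\<lambda>i. f i * (real i * h) powr k) summable_on {1..}"

text \<open>In the following two definitions, \<open>a\<close> and \<open>b\<close> stand for \<open>\<alpha> 1\<close> and \<open>\<beta> 1\<close>.\<close>

definition C_const :: "real \<Rightarrow> real \<Rightarrow> real \<Rightarrow> real \<Rightarrow> real"
  where "C_const a b \<delta> k =
    (\<delta> - 2 * a - b + 1) / (\<delta> + k - 1)
    * (2 powr (b + 1) * (2 powr k - 2)) powr ((\<delta> + k - 1) / (\<delta> - 2 * a - b + 1))
    * (2 * (2 * a + b + k - 2) / (\<delta> + k - 1)) powr ((2 * a + b + k - 2) / (\<delta> - 2 * a - b + 1))"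

definition B_bound :: "real \<Rightarrow> real \<Rightarrow> real \<Rightarrow> real \<Rightarrow> real \<Rightarrow> real"
  where "B_bound a b \<delta> k x =
    (2 * C_const a b \<delta> k
      * x powr (1 + (\<delta> + k - 1) / (\<delta> - 2 * a - b + 1) + \<delta> / (k - 1))) powr ((k - 1) / (\<delta> + k - 1))"

text \<open>A global classical solution: \<open>f\<close> is continuously differentiable from \<open>[0, \<infinity>)\<close> (one-sided
  derivative at 0) to $\ell^1$ in the norm topology, with derivative \<open>g t = O[f t]\<close>.  A bound on a
  moment includes its finiteness.\<close>

definition is_solution ::
    "real \<Rightarrow> (nat \<Rightarrow> real) \<Rightarrow> (nat \<Rightarrow> real) \<Rightarrow> real \<Rightarrow> real \<Rightarrow> (nat \<Rightarrow> real) \<Rightarrow> (real \<Rightarrow> ell1) \<Rightarrow> bool"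
  where "is_solution h \<alpha> \<beta> \<delta> \<kappa> f0 f \<longleftrightarrow>
    (\<exists>g. continuous_on {0..} g \<and>
      (\<forall>t\<ge>0. (f has_vector_derivative g t) (at t within {0..}) \<and>
        (\<forall>i\<ge>1. ell1_nth (g t) i = O_op h \<alpha> \<beta> \<delta> (ell1_nth (f t)) i))) \<and>
    (\<forall>i\<ge>1. ell1_nth (f 0) i = f0 i) \<and>
    (\<forall>t\<ge>0.
      (\<forall>i\<ge>1. 0 \<le> ell1_nth (f t) i) \<and>
      finite_moment h 1 (ell1_nth (f t)) \<and>
      moment h 1 (ell1_nth (f t)) \<le> moment h 1 f0 \<and>
      finite_moment h \<kappa> (ell1_nth (f t)) \<and>
      moment h \<kappa> (ell1_nth (f t))
        \<le> max (moment h \<kappa> f0) (2 * B_bound (\<alpha> 1) (\<beta> 1) \<delta> \<kappa> (moment h 1 f0)))"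

end

theory Submission
  imports Defs
begin

text \<open>
  The first moment is tested through its truncations \<open>M\<^sub>R = \<Sum>\<^sub>i \<phi>\<^sub>i f\<^sub>i\<close>, \<open>\<phi>\<^sub>i = min (i h) R\<close>, which are
  bounded linear functionals on $\ell^1$ and hence differentiable along the solution.  As \<open>\<phi>\<close> is
  subadditive, coagulation contributes nonpositively.  Fragmentation contributes through the defect
  \<open>\<phi>\<^sub>j + \<phi>\<^sub>l - \<phi>\<^sub>j\<^sub>+\<^sub>l\<close>, which is at most \<open>\<phi>\<^sub>j\<^sub>+\<^sub>l\<close> and vanishes when \<open>(j + l) h \<le> R\<close>; since
  \<open>\<alpha>\<^sub>n + \<beta>\<^sub>n < \<delta>\<close>, it is therefore at most \<open>\<epsilon>\<^sub>R\<close> times the dissipation \<open>\<Sum>\<^sub>i \<phi>\<^sub>i (i h)\<^sup>\<delta> f\<^sub>i\<close>, where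
  \<open>\<epsilon>\<^sub>R\<close> tends to 0 uniformly in time by the bound on the moment of order \<open>\<kappa>\<close>.  So
  \<open>M\<^sub>R' \<le> - (1 - \<epsilon>\<^sub>R) h\<^sup>\<delta> M\<^sub>R\<close>, and letting \<open>R\<close> tend to infinity gives the claim.  The moments of
  order \<open>1 + \<alpha>\<^sub>n + \<beta>\<^sub>n\<close> needed for testing with \<open>\<phi>\<^sub>i = i h\<close> directly may be infinite.
\<close>

section \<open>Double series over pairs of sizes\<close>

lemma summable_on_times_real:
  fixes u :: "'a \<Rightarrow> real" and v :: "'b \<Rightarrow> real"
  assumes "u summable_on A" "v summable_on B"
    and "\<And>x. x \<in> A \<Longrightarrow> 0 \<le> u x" "\<And>y. y \<in> B \<Longrightarrow> 0 \<le> v y"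
  shows "(\<lambda>(x, y). u x * v y) summable_on A \<times> B"
proof (rule summable_on_SigmaI)
  show "((\<lambda>y. case (x, y) of (x, y) \<Rightarrow> u x * v y) has_sum u x * infsum v B) B" for x
    using assms(2) by (auto intro!: has_sum_cmult_right)
  show "(\<lambda>x. u x * infsum v B) summable_on A"
    using assms(1) by (rule summable_on_cmult_left)
qed (use assms in auto)

lemma has_sum_times_real:
  fixes u :: "'a \<Rightarrow> real" and v :: "'b \<Rightarrow> real"
  assumes "u summable_on A" "v summable_on B"
    and "\<And>x. x \<in> A \<Longrightarrow> 0 \<le> u x" "\<And>y. y \<in> B \<Longrightarrow> 0 \<le> v y"
  shows "((\<lambda>(x, y). u x * v y) has_sum infsum u A * infsum v B) (A \<times> B)"
proof (rule has_sum_SigmaI)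
  show "((\<lambda>y. case (x, y) of (x, y) \<Rightarrow> u x * v y) has_sum u x * infsum v B) B" for x
    using assms(2) by (auto intro!: has_sum_cmult_right)
  show "((\<lambda>x. u x * infsum v B) has_sum infsum u A * infsum v B) A"
    using assms(1) by (auto intro!: has_sum_cmult_left)
qed (use summable_on_times_real[OF assms] in auto)

lemma has_sum_diff_real:
  fixes u v :: "'a \<Rightarrow> real"
  assumes "(u has_sum a) A" "(v has_sum b) A"
  shows "((\<lambda>x. u x - v x) has_sum a - b) A"
  using has_sum_add[OF assms(1) has_sum_uminusI[OF assms(2)]] by simp

lemma has_sum_rows:
  fixes P :: "nat \<Rightarrow> nat \<Rightarrow> real"
  assumes "((\<lambda>(i, j). P i j) has_sum s) ({1..} \<times> {1..})"
  shows "((\<lambda>i. \<Sum>\<^sub>\<infinity>j\<in>{1..}. P i j) has_sum s) {1..}"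
proof (rule has_sum_SigmaD[OF assms])
  fix i :: nat assume "i \<in> {1..}"
  then have "P i summable_on {1..}"
    by (rule summable_on_SigmaD1[OF has_sum_imp_summable[OF assms]])
  then show "((\<lambda>j. case (i, j) of (i, j) \<Rightarrow> P i j) has_sum (\<Sum>\<^sub>\<infinity>j\<in>{1..}. P i j)) {1..}"
    by simp
qed

lemma has_sum_columns:
  fixes P :: "nat \<Rightarrow> nat \<Rightarrow> real"
  assumes "((\<lambda>(i, j). P i j) has_sum s) ({1..} \<times> {1..})"
  shows "((\<lambda>j. \<Sum>\<^sub>\<infinity>i\<in>{1..}. P i j) has_sum s) {1..}"
  using has_sum_rows[of "\<lambda>i j. P j i" s] assms
  by (subst (asm) has_sum_swap) simp

text \<open>Setting \<open>i = j + l\<close> matches the pairs \<open>(j, l)\<close> bijectively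
  with the pairs \<open>(i, j)\<close>, \<open>1 \<le> j < i\<close>. For each \<open>i\<close> only
  finitely many \<open>j\<close> occur, so the inner sums exist automatically.\<close>

lemma has_sum_antidiagonals:
  fixes P :: "nat \<Rightarrow> nat \<Rightarrow> real"
  assumes "((\<lambda>(i, j). P i j) has_sum s) ({1..} \<times> {1..})"
  shows "((\<lambda>i. \<Sum>j = 1..<i. P j (i - j)) has_sum s) {1..}"
proof (rule has_sum_SigmaD)
  show "((\<lambda>(i, j). P j (i - j)) has_sum s) (Sigma {1..} (\<lambda>i. {1..<i}))"
    by (subst has_sum_reindex_bij_witness[where T = "{1..} \<times> {1..}" and h = "\<lambda>(i, j). P i j"
          and s' = s and i = "\<lambda>(j, l). (j + l, j)" and j = "\<lambda>(i, j). (j, i - j)"])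
      (use assms in auto)
qed (simp add: has_sum_finite_iff)

lemma infsum_shift:
  fixes g :: "nat \<Rightarrow> real"
  shows "(\<Sum>\<^sub>\<infinity>j\<in>{i+1..}. g j) = (\<Sum>\<^sub>\<infinity>l\<in>{1..}. g (l + i))"
  by (rule infsum_reindex_bij_witness[where i = "\<lambda>l. l + i" and j = "\<lambda>j. j - i"]) auto

section \<open>Weak forms of the coagulation and fragmentation operators\<close>

text \<open>Each merger removes \<open>j\<close> and \<open>l\<close> and creates
  \<open>j + l\<close>. The gain term collects antidiagonals; the loss term is shared equally
  between rows and columns. Weights bounded by \<open>R\<close> make the three double series
  converge separately, so the rearrangement is legitimate.\<close>

lemma has_sum_coag_op:
  fixes \<phi> u :: "nat \<Rightarrow> real" and a b h :: real
  defines "G \<equiv> \<lambda>j l. kernel a b (real j * h) (real l * h) * u j * u l"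
  assumes G: "(\<lambda>(j, l). G j l) summable_on {1..} \<times> {1..}"
    and nn: "\<And>j. j \<ge> 1 \<Longrightarrow> 0 \<le> u j"
    and \<phi>: "\<And>j. 0 \<le> \<phi> j" "\<And>j. \<phi> j \<le> R"
  shows "((\<lambda>i. \<phi> i * coag_op h a b u i) has_sum
     (\<Sum>\<^sub>\<infinity>(j, l)\<in>{1..}\<times>{1..}. (\<phi> (j + l) - \<phi> j - \<phi> l) * G j l)) {1..}"
proof -
  have G0: "0 \<le> G j l" if "j \<ge> 1" "l \<ge> 1" for j l
    using nn that by (simp add: G_def kernel_def)
  \<comment> \<open>\<open>p\<close> selects the size that carries the weight; it becomes
    \<open>j + l\<close>, \<open>j\<close> and \<open>l\<close> in turn.\<close>
  have summ: "(\<lambda>(j, l). \<phi> (p j l) * G j l) summable_on {1..} \<times> {1..}" for p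
    by (rule summable_on_comparison_test[OF summable_on_cmult_right[OF G, of R]])
      (use \<phi> G0 in \<open>auto intro!: mult_right_mono\<close>)
  define s where "s p = (\<Sum>\<^sub>\<infinity>(j, l)\<in>{1..}\<times>{1..}. \<phi> (p j l) * G j l)" for p
  have hs: "((\<lambda>(j, l). \<phi> (p j l) * G j l) has_sum s p) ({1..} \<times> {1..})" for p
    unfolding s_def using summ[of p] by (rule has_sum_infsum)
  note total = has_sum_diff_real[OF has_sum_diff_real[OF hs[of "\<lambda>j l. j + l"] hs[of "\<lambda>j l. j"]] hs[of "\<lambda>j l. l"]]
  have sym: "G j l = G l j" for j l
    by (simp add: G_def kernel_def algebra_simps)
  \<comment> \<open>Leaving \<open>j + (i - j)\<close> unsimplified keeps the summand a literal
    instance of \<open>P j (i - j)\<close>; it equals \<open>i\<close> in the range of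
    summation.\<close>
  have "((\<lambda>i. (\<Sum>j = 1..<i. \<phi> (j + (i - j)) * G j (i - j))
      - (\<Sum>\<^sub>\<infinity>j\<in>{1..}. \<phi> i * G i j) - (\<Sum>\<^sub>\<infinity>j\<in>{1..}. \<phi> i * G j i)) has_sum
      s (\<lambda>j l. j + l) - s (\<lambda>j l. j) - s (\<lambda>j l. l)) {1..}"
    by (intro has_sum_diff_real has_sum_antidiagonals has_sum_rows has_sum_columns hs)
  moreover have "(\<Sum>j = 1..<i. \<phi> (j + (i - j)) * G j (i - j))
      - (\<Sum>\<^sub>\<infinity>j\<in>{1..}. \<phi> i * G i j) - (\<Sum>\<^sub>\<infinity>j\<in>{1..}. \<phi> i * G j i) = \<phi> i * coag_op h a b u i" for i
  proof -
    \<comment> \<open>By symmetry of \<open>G\<close> the row and column sums agree and together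
      give the factor 2 of the loss term.\<close>
    have "(\<Sum>\<^sub>\<infinity>j\<in>{1..}. G j i) = (\<Sum>\<^sub>\<infinity>j\<in>{1..}. G i j)"
      by (intro infsum_cong sym)
    then show ?thesis
      by (simp add: infsum_cmult_right' coag_op_def G_def sum_distrib_left algebra_simps)
  qed
  moreover have "s (\<lambda>j l. j + l) - s (\<lambda>j l. j) - s (\<lambda>j l. l)
    = (\<Sum>\<^sub>\<infinity>(j, l)\<in>{1..}\<times>{1..}. (\<phi> (j + l) - \<phi> j - \<phi> l) * G j l)"
    using total by (intro infsumI[symmetric]) (simp add: case_prod_unfold algebra_simps)
  ultimately show ?thesis by simp
qed

text \<open>\<open>F j l\<close> is the rate at which size \<open>j + l\<close> is replaced by
  \<open>j\<close> and \<open>l\<close>. Antidiagonals give the loss term, rows the first gain term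
  and columns the second; the two gain terms stay distinct because \<open>F\<close> is in general
  not symmetric.\<close>

lemma has_sum_frag_op:
  fixes \<phi> u :: "nat \<Rightarrow> real" and a b h :: real
  defines "F \<equiv> \<lambda>j l. kernel a b (real l * h) (real j * h) * u (j + l) * u j"
  assumes F: "(\<lambda>(j, l). F j l) summable_on {1..} \<times> {1..}"
    and nn: "\<And>j. j \<ge> 1 \<Longrightarrow> 0 \<le> u j"
    and \<phi>: "\<And>j. 0 \<le> \<phi> j" "\<And>j. \<phi> j \<le> R"
  shows "((\<lambda>i. \<phi> i * frag_op h a b u i) has_sum
     (\<Sum>\<^sub>\<infinity>(j, l)\<in>{1..}\<times>{1..}. (\<phi> j + \<phi> l - \<phi> (j + l)) * F j l)) {1..}"
proof -
  have F0: "0 \<le> F j l" if "j \<ge> 1" "l \<ge> 1" for j l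
    using nn that by (simp add: F_def kernel_def)
  have summ: "(\<lambda>(j, l). \<phi> (p j l) * F j l) summable_on {1..} \<times> {1..}" for p
    by (rule summable_on_comparison_test[OF summable_on_cmult_right[OF F, of R]])
      (use \<phi> F0 in \<open>auto intro!: mult_right_mono\<close>)
  define s where "s p = (\<Sum>\<^sub>\<infinity>(j, l)\<in>{1..}\<times>{1..}. \<phi> (p j l) * F j l)" for p
  have hs: "((\<lambda>(j, l). \<phi> (p j l) * F j l) has_sum s p) ({1..} \<times> {1..})" for p
    unfolding s_def using summ[of p] by (rule has_sum_infsum)
  note total = has_sum_diff_real[OF has_sum_add[OF hs[of "\<lambda>j l. j"] hs[of "\<lambda>j l. l"]] hs[of "\<lambda>j l. j + l"]]
  have "((\<lambda>i. (\<Sum>\<^sub>\<infinity>l\<in>{1..}. \<phi> i * F i l) + (\<Sum>\<^sub>\<infinity>l\<in>{1..}. \<phi> i * F l i)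
      - (\<Sum>j = 1..<i. \<phi> (j + (i - j)) * F j (i - j))) has_sum
      s (\<lambda>j l. j) + s (\<lambda>j l. l) - s (\<lambda>j l. j + l)) {1..}"
    by (intro has_sum_diff_real has_sum_add has_sum_antidiagonals has_sum_rows has_sum_columns hs)
  moreover have "(\<Sum>\<^sub>\<infinity>l\<in>{1..}. \<phi> i * F i l) + (\<Sum>\<^sub>\<infinity>l\<in>{1..}. \<phi> i * F l i)
      - (\<Sum>j = 1..<i. \<phi> (j + (i - j)) * F j (i - j)) = \<phi> i * frag_op h a b u i" for i
  proof -
    have "(\<Sum>\<^sub>\<infinity>j\<in>{i+1..}. kernel a b (real (j - i) * h) (real i * h) * u i * u j)
        = (\<Sum>\<^sub>\<infinity>l\<in>{1..}. F i l)"
      unfolding infsum_shift by (intro infsum_cong) (simp add: F_def add.commute)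
    moreover have "(\<Sum>\<^sub>\<infinity>j\<in>{i+1..}. kernel a b (real i * h) (real (j - i) * h) * u j * u (j - i))
        = (\<Sum>\<^sub>\<infinity>l\<in>{1..}. F l i)"
      unfolding infsum_shift by (intro infsum_cong) (simp add: F_def add.commute)
    moreover have "(\<Sum>j = 1..<i. \<phi> (j + (i - j)) * F j (i - j))
        = \<phi> i * (\<Sum>j = 1..<i. kernel a b (real (i - j) * h) (real j * h) * u i * u j)"
      unfolding sum_distrib_left by (intro sum.cong) (auto simp: F_def)
    ultimately show ?thesis
      by (simp add: infsum_cmult_right' frag_op_def algebra_simps)
  qed
  moreover have "s (\<lambda>j l. j) + s (\<lambda>j l. l) - s (\<lambda>j l. j + l)
    = (\<Sum>\<^sub>\<infinity>(j, l)\<in>{1..}\<times>{1..}. (\<phi> j + \<phi> l - \<phi> (j + l)) * F j l)"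
    using total by (intro infsumI[symmetric]) (simp add: case_prod_unfold algebra_simps)
  ultimately show ?thesis by simp
qed


section \<open>Moment and kernel bounds that decouple double series\<close>

text \<open>Sending \<open>(j, l)\<close> to \<open>(j + l, j)\<close> is injective but reaches only
  pairs whose first entry exceeds the second, hence an inequality. It allows a product of a factor
  at \<open>j + l\<close> and a factor at \<open>j\<close> to be bounded by a product of two single
  series.\<close>

lemma summable_on_shear:
  fixes P :: "nat \<Rightarrow> nat \<Rightarrow> real"
  assumes "(\<lambda>(i, j). P i j) summable_on {1..} \<times> {1..}"
    and nn: "\<And>i j. i \<ge> 1 \<Longrightarrow> j \<ge> 1 \<Longrightarrow> 0 \<le> P i j"
  shows "(\<lambda>(j, l). P (j + l) j) summable_on {1..} \<times> {1..}"
    and "(\<Sum>\<^sub>\<infinity>(j, l)\<in>{1..}\<times>{1..}. P (j + l) j) \<le> (\<Sum>\<^sub>\<infinity>(i, j)\<in>{1..}\<times>{1..}. P i j)"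
proof -
  define g :: "nat \<times> nat \<Rightarrow> nat \<times> nat" where "g = (\<lambda>(j, l). (j + l, j))"
  have inj: "inj_on g ({1..} \<times> {1..})"
    by (auto simp: inj_on_def g_def)
  have sub: "g ` ({1..} \<times> {1..}) \<subseteq> {1..} \<times> {1..}"
    by (auto simp: g_def)
  have eq: "(\<lambda>(j, l). P (j + l) j) = (\<lambda>(i, j). P i j) \<circ> g"
    by (auto simp: g_def)
  have s: "(\<lambda>(i, j). P i j) summable_on g ` ({1..} \<times> {1..})"
    using assms(1) sub by (rule summable_on_subset)
  then show "(\<lambda>(j, l). P (j + l) j) summable_on {1..} \<times> {1..}"
    unfolding eq by (simp only: summable_on_reindex[OF inj])
  show "(\<Sum>\<^sub>\<infinity>(j, l)\<in>{1..}\<times>{1..}. P (j + l) j) \<le> (\<Sum>\<^sub>\<infinity>(i, j)\<in>{1..}\<times>{1..}. P i j)"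
    unfolding eq infsum_reindex[OF inj, symmetric]
    using s assms(1) sub nn by (intro infsum_mono_neutral) auto
qed

text \<open>No size is below the mesh \<open>h\<close>, so the decreasing power with exponent
  \<open>p - q\<close> is largest at \<open>i = 1\<close>.\<close>

lemma finite_moment_lower:
  assumes "h > 0" "p \<le> q" and nn: "\<And>i. i \<ge> 1 \<Longrightarrow> 0 \<le> u i" and q: "finite_moment h q u"
  shows "finite_moment h p u" and "moment h p u \<le> h powr (p - q) * moment h q u"
proof -
  have le: "u i * (real i * h) powr p \<le> h powr (p - q) * (u i * (real i * h) powr q)"
    if "i \<in> {1..}" for i
  proof -
    have "(real i * h) powr (p - q) \<le> h powr (p - q)"
      using that assms by (intro powr_mono2') auto
    then have "(real i * h) powr (p - q) * (real i * h) powr q \<le> h powr (p - q) * (real i * h) powr q"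
      by (rule mult_right_mono) simp
    then have "(real i * h) powr p \<le> h powr (p - q) * (real i * h) powr q"
      by (simp flip: powr_add)
    then have "u i * (real i * h) powr p \<le> u i * (h powr (p - q) * (real i * h) powr q)"
      using nn that by (intro mult_left_mono) auto
    then show ?thesis by (simp add: algebra_simps)
  qed
  have s: "(\<lambda>i. h powr (p - q) * (u i * (real i * h) powr q)) summable_on {1..}"
    using q unfolding finite_moment_def by (rule summable_on_cmult_right)
  show p: "finite_moment h p u"
    unfolding finite_moment_def
    by (rule summable_on_comparison_test[OF s le]) (use nn in auto)
  have "moment h p u \<le> (\<Sum>\<^sub>\<infinity>i\<in>{1..}. h powr (p - q) * (u i * (real i * h) powr q))"
    unfolding moment_def using p s le by (intro infsum_mono) (auto simp: finite_moment_def)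
  then show "moment h p u \<le> h powr (p - q) * moment h q u"
    by (simp add: moment_def infsum_cmult_right')
qed

text \<open>\<open>x + y\<close> is at most twice the maximum, whose power is one of
  \<open>x powr b\<close> and \<open>y powr b\<close>. The result is a sum of products, so the
  coagulation series is controlled by moments of order \<open>a\<close> and
  \<open>a + b\<close>.\<close>

lemma kernel_le_sum:
  assumes "0 \<le> x" "0 \<le> y" "0 \<le> b"
  shows "kernel a b x y \<le> 2 powr b * (x powr a * y powr (a + b) + x powr (a + b) * y powr a)"
proof -
  have "(x + y) powr b \<le> (2 * max x y) powr b"
    using assms by (intro powr_mono2) auto
  also have "\<dots> \<le> 2 powr b * (y powr b + x powr b)"
    using assms by (auto simp: powr_mult max_def)
  finally have "x powr a * y powr a * (x + y) powr b
      \<le> x powr a * y powr a * (2 powr b * (y powr b + x powr b))"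
    by (rule mult_left_mono) simp
  then show ?thesis
    by (simp add: kernel_def powr_add algebra_simps)
qed

text \<open>The factor in \<open>y\<close> is absorbed into the parent size \<open>x + y\<close>.
  What remains separates in the variables \<open>x + y\<close> and \<open>x\<close>, the form
  required by \<open>summable_on_shear\<close>.\<close>

lemma kernel_le_add_powr:
  assumes "0 \<le> x" "0 \<le> y" "0 \<le> a"
  shows "kernel a b y x \<le> (x + y) powr (a + b) * x powr a"
proof -
  have "y powr a \<le> (x + y) powr a"
    using assms by (intro powr_mono2) auto
  then have "y powr a * (x powr a * (x + y) powr b) \<le> (x + y) powr a * (x powr a * (x + y) powr b)"
    by (rule mult_right_mono) simp
  then show ?thesis
    by (simp add: kernel_def powr_add add.commute algebra_simps)
qed

section \<open>Estimates of the operators tested with truncated weights\<close>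

text \<open>Subadditivity of \<open>\<phi>\<close> makes every term of the weak form nonpositive.
  Since \<open>\<phi>\<close> is bounded, moments of order \<open>a\<close> and \<open>a + b\<close>
  suffice for convergence.\<close>

lemma infsum_coag_op_nonpos:
  assumes "h > 0" "0 \<le> b" and nn: "\<And>i. i \<ge> 1 \<Longrightarrow> 0 \<le> u i"
    and fm: "finite_moment h a u" "finite_moment h (a + b) u"
    and \<phi>: "\<And>j. 0 \<le> \<phi> j" "\<And>j. \<phi> j \<le> R" "\<And>i j. \<phi> (i + j) \<le> \<phi> i + \<phi> j"
  shows "(\<lambda>i. \<phi> i * coag_op h a b u i) summable_on {1..}"
    and "(\<Sum>\<^sub>\<infinity>i\<in>{1..}. \<phi> i * coag_op h a b u i) \<le> 0"
proof -
  define v where "v p i = u i * (real i * h) powr p" for p i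
  have v: "v a summable_on {1..}" "v (a + b) summable_on {1..}" "\<And>p i. i \<in> {1..} \<Longrightarrow> 0 \<le> v p i"
    using fm nn by (auto simp: v_def[abs_def] finite_moment_def)
  have "(\<lambda>(j, l). 2 powr b * (v a j * v (a + b) l + v (a + b) j * v a l)) summable_on {1..} \<times> {1..}"
    using summable_on_cmult_right[OF summable_on_add[OF
      summable_on_times_real[OF v(1,2) v(3,3)] summable_on_times_real[OF v(2,1) v(3,3)]], of "2 powr b"]
    by (simp add: case_prod_unfold)
  then have G: "(\<lambda>(j, l). kernel a b (real j * h) (real l * h) * u j * u l) summable_on {1..} \<times> {1..}"
  proof (rule summable_on_comparison_test)
    fix x :: "nat \<times> nat" assume "x \<in> {1..} \<times> {1..}"
    moreover obtain j l where [simp]: "x = (j, l)" by force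
    ultimately have *: "0 \<le> u j" "0 \<le> u l" using nn by auto
    have "kernel a b (real j * h) (real l * h) * (u j * u l) \<le>
       2 powr b * ((real j * h) powr a * (real l * h) powr (a + b)
         + (real j * h) powr (a + b) * (real l * h) powr a) * (u j * u l)"
      using assms * by (intro mult_right_mono kernel_le_sum) auto
    then show "(case x of (j, l) \<Rightarrow> kernel a b (real j * h) (real l * h) * u j * u l)
      \<le> (case x of (j, l) \<Rightarrow> 2 powr b * (v a j * v (a + b) l + v (a + b) j * v a l))"
      by (simp add: v_def algebra_simps)
    show "0 \<le> (case x of (j, l) \<Rightarrow> kernel a b (real j * h) (real l * h) * u j * u l)"
      using * by (simp add: kernel_def)
  qed
  note hs = has_sum_coag_op[OF G nn \<phi>(1,2)]
  show "(\<lambda>i. \<phi> i * coag_op h a b u i) summable_on {1..}"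
    using hs by (rule has_sum_imp_summable)
  define T where "T = (\<lambda>(j, l). (\<phi> (j + l) - \<phi> j - \<phi> l) * (kernel a b (real j * h) (real l * h) * u j * u l))"
  have "0 \<le> (\<Sum>\<^sub>\<infinity>x\<in>{1..}\<times>{1..}. - T x)"
    using nn \<phi>(3)
    by (intro infsum_nonneg) (auto simp: T_def kernel_def diff_diff_eq intro!: mult_nonpos_nonneg)
  then have "infsum T ({1..} \<times> {1..}) \<le> 0"
    by (simp only: infsum_uminus)
  moreover have "(\<Sum>\<^sub>\<infinity>i\<in>{1..}. \<phi> i * coag_op h a b u i) = infsum T ({1..} \<times> {1..})"
    unfolding T_def by (rule infsumI[OF hs])
  ultimately show "(\<Sum>\<^sub>\<infinity>i\<in>{1..}. \<phi> i * coag_op h a b u i) \<le> 0"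
    by simp
qed

text \<open>Only parents larger than \<open>R\<close> contribute, and for them order
  \<open>a + b\<close> is traded for order \<open>\<delta>\<close> at the price
  \<open>R powr (a + b - \<delta>)\<close>. After the shear the series factors into the dissipation
  and the moment of order \<open>a\<close>.\<close>

lemma infsum_frag_op_le:
  fixes R h :: real
  defines "\<phi> \<equiv> \<lambda>i::nat. min (real i * h) R"
  assumes "h > 0" "R > 0" "0 \<le> a" and ab: "a + b \<le> \<delta>" and nn: "\<And>i. i \<ge> 1 \<Longrightarrow> 0 \<le> u i"
    and fm: "finite_moment h a u" "finite_moment h \<delta> u"
  shows "(\<lambda>i. \<phi> i * frag_op h a b u i) summable_on {1..}"
    and "(\<Sum>\<^sub>\<infinity>i\<in>{1..}. \<phi> i * frag_op h a b u i)
      \<le> R powr (a + b - \<delta>) * moment h a u * (\<Sum>\<^sub>\<infinity>i\<in>{1..}. \<phi> i * V_op h \<delta> u i)"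
proof -
  define v where "v p i = u i * (real i * h) powr p" for p i
  have ab': "finite_moment h (a + b) u"
    using finite_moment_lower(1)[OF \<open>h > 0\<close> ab nn fm(2)] by simp
  have v: "v a summable_on {1..}" "v (a + b) summable_on {1..}" "v \<delta> summable_on {1..}"
    "\<And>p i. i \<in> {1..} \<Longrightarrow> 0 \<le> v p i"
    using fm ab' nn by (auto simp: v_def[abs_def] finite_moment_def)
  have \<phi>: "0 \<le> \<phi> j" "\<phi> j \<le> R" for j
    using assms by (auto simp: \<phi>_def)
  define F where "F j l = kernel a b (real l * h) (real j * h) * u (j + l) * u j" for j l
  have Fle: "F j l \<le> v (a + b) (j + l) * v a j" and F0: "0 \<le> F j l" if "j \<ge> 1" "l \<ge> 1" for j l
  proof -
    have *: "0 \<le> u j" "0 \<le> u (j + l)" using nn that by auto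
    have "kernel a b (real l * h) (real j * h) * (u (j + l) * u j) \<le>
       ((real j * h + real l * h) powr (a + b) * (real j * h) powr a) * (u (j + l) * u j)"
      using assms * by (intro mult_right_mono kernel_le_add_powr) auto
    then show "F j l \<le> v (a + b) (j + l) * v a j"
      by (simp add: F_def v_def algebra_simps)
    show "0 \<le> F j l"
      using * by (simp add: F_def kernel_def)
  qed
  have "(\<lambda>(j, l). v (a + b) (j + l) * v a j) summable_on {1..} \<times> {1..}"
    by (rule summable_on_shear(1)[OF summable_on_times_real[OF v(2,1) v(4,4)]]) (use v(4) in auto)
  then have Fs: "(\<lambda>(j, l). F j l) summable_on {1..} \<times> {1..}"
    by (rule summable_on_comparison_test) (use Fle F0 in auto)
  note hs = has_sum_frag_op[OF Fs[unfolded F_def] nn \<phi>, folded F_def]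
  show "(\<lambda>i. \<phi> i * frag_op h a b u i) summable_on {1..}"
    using hs by (rule has_sum_imp_summable)
  \<comment> \<open>\<open>E\<close> is the factor gained from large parents; \<open>w\<close> is
    the dissipation density scaled by it.\<close>
  define E where "E = R powr (a + b - \<delta>)"
  define w where "w i = E * (\<phi> i * v \<delta> i)" for i
  have w: "w summable_on {1..}" "\<And>i. i \<in> {1..} \<Longrightarrow> 0 \<le> w i"
  proof -
    have "(\<lambda>i. \<phi> i * v \<delta> i) summable_on {1..}"
      by (rule summable_on_comparison_test[OF summable_on_cmult_right[OF v(3), of R]])
        (use \<phi> v(4) in \<open>auto intro!: mult_right_mono\<close>)
    then show "w summable_on {1..}"
      unfolding w_def by (rule summable_on_cmult_right)
    show "0 \<le> w i" if "i \<in> {1..}" for i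
      using \<phi>(1)[of i] v(4)[OF that] by (auto simp: w_def E_def)
  qed
  have wv: "((\<lambda>(i, j). w i * v a j) has_sum infsum w {1..} * infsum (v a) {1..}) ({1..} \<times> {1..})"
    using has_sum_times_real[OF w(1) v(1) w(2) v(4)] by simp
  have wv0: "0 \<le> w i * v a j" if "i \<ge> 1" "j \<ge> 1" for i j
    using w(2) v(4) that by simp
  note shear = summable_on_shear[OF has_sum_imp_summable[OF wv] wv0]
  have le: "(\<phi> j + \<phi> l - \<phi> (j + l)) * F j l \<le> w (j + l) * v a j" if jl: "j \<ge> 1" "l \<ge> 1" for j l
  proof (cases "real (j + l) * h \<le> R")
    case True
    \<comment> \<open>If the parent is at most \<open>R\<close>, so are both fragments; no
      truncation is active and mass is conserved.\<close>
    have "0 \<le> real j * h" "0 \<le> real l * h" using assms by auto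
    with True have "\<phi> j + \<phi> l - \<phi> (j + l) = 0"
      by (simp add: \<phi>_def algebra_simps)
    then show ?thesis using wv0 jl by simp
  next
    case False
    have "\<phi> j \<le> \<phi> (j + l)" "\<phi> l \<le> \<phi> (j + l)"
      unfolding \<phi>_def using assms by (intro min.mono mult_right_mono; simp)+
    then have "(\<phi> j + \<phi> l - \<phi> (j + l)) * F j l \<le> \<phi> (j + l) * F j l"
      using F0[OF jl] by (intro mult_right_mono) auto
    also have "\<dots> \<le> \<phi> (j + l) * (v (a + b) (j + l) * v a j)"
      using \<phi> Fle[OF jl] by (intro mult_left_mono) auto
    also have "v (a + b) (j + l) \<le> E * v \<delta> (j + l)"
    proof -
      \<comment> \<open>The parent exceeds \<open>R\<close> and the exponent is at most 0.\<close>
      have "(real (j + l) * h) powr (a + b - \<delta>) \<le> E"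
        unfolding E_def using False assms by (intro powr_mono2') auto
      then have "(real (j + l) * h) powr (a + b - \<delta>) * v \<delta> (j + l) \<le> E * v \<delta> (j + l)"
        using v(4) jl by (intro mult_right_mono) auto
      then show ?thesis
        by (simp add: v_def mult.left_commute flip: powr_add)
    qed
    then have "\<phi> (j + l) * (v (a + b) (j + l) * v a j) \<le> \<phi> (j + l) * (E * v \<delta> (j + l) * v a j)"
      using \<phi> v(4) jl by (intro mult_left_mono mult_right_mono) auto
    also have "\<dots> = w (j + l) * v a j"
      by (simp add: w_def)
    finally show ?thesis .
  qed
  \<comment> \<open>Subadditivity of \<open>\<phi>\<close>; the comparison test below requires
    nonnegative terms.\<close>
  have defect: "0 \<le> \<phi> j + \<phi> l - \<phi> (j + l)" for j l
  proof -
    have "0 \<le> real j * h" "0 \<le> real l * h" using assms by auto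
    then show ?thesis using \<open>R > 0\<close> by (auto simp: \<phi>_def min_def algebra_simps)
  qed
  have "(\<Sum>\<^sub>\<infinity>i\<in>{1..}. \<phi> i * frag_op h a b u i)
      = (\<Sum>\<^sub>\<infinity>(j, l)\<in>{1..}\<times>{1..}. (\<phi> j + \<phi> l - \<phi> (j + l)) * F j l)"
    by (rule infsumI[OF hs])
  also have "\<dots> \<le> (\<Sum>\<^sub>\<infinity>(j, l)\<in>{1..}\<times>{1..}. w (j + l) * v a j)"
  proof (rule infsum_mono)
    show "(\<lambda>(j, l). (\<phi> j + \<phi> l - \<phi> (j + l)) * F j l) summable_on {1..} \<times> {1..}"
      by (rule summable_on_comparison_test[OF shear(1)]) (use le defect F0 in auto)
  qed (use le shear(1) in auto)
  also have "\<dots> \<le> infsum w {1..} * infsum (v a) {1..}"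
    using shear(2) infsumI[OF wv] by simp
  also have "\<dots> = E * moment h a u * (\<Sum>\<^sub>\<infinity>i\<in>{1..}. \<phi> i * V_op h \<delta> u i)"
    by (simp add: w_def[abs_def] v_def[abs_def] moment_def infsum_cmult_right' V_op_def mult.commute mult.left_commute)
  finally show "(\<Sum>\<^sub>\<infinity>i\<in>{1..}. \<phi> i * frag_op h a b u i)
      \<le> R powr (a + b - \<delta>) * moment h a u * (\<Sum>\<^sub>\<infinity>i\<in>{1..}. \<phi> i * V_op h \<delta> u i)"
    by (simp add: E_def)
qed


text \<open>Coagulation is dropped by its sign, fragmentation consumes at most the share
  \<open>\<epsilon>\<close> of the dissipation, and the rest dominates the truncated moment because
  every size is at least \<open>h\<close>.\<close>

lemma infsum_truncated_O_op_le:
  fixes R h \<delta> \<epsilon> :: real and \<alpha> \<beta> :: "nat \<Rightarrow> real"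
  defines "\<phi> \<equiv> \<lambda>i::nat. min (real i * h) R"
  assumes "h > 0" "R > 0" "0 \<le> \<delta>"
    and ab: "\<And>n. n \<in> {1, 2, 3} \<Longrightarrow> 0 \<le> \<alpha> n \<and> 0 \<le> \<beta> n \<and> \<alpha> n + \<beta> n \<le> \<delta>"
    and nn: "\<And>i. i \<ge> 1 \<Longrightarrow> 0 \<le> u i" and fm: "finite_moment h \<delta> u"
    and \<epsilon>: "(\<Sum>n\<in>{2, 3}. R powr (\<alpha> n + \<beta> n - \<delta>) * moment h (\<alpha> n) u) \<le> \<epsilon>" "\<epsilon> \<le> 1"
  shows "(\<Sum>\<^sub>\<infinity>i\<in>{1..}. \<phi> i * O_op h \<alpha> \<beta> \<delta> u i)
    \<le> - ((1 - \<epsilon>) * h powr \<delta>) * (\<Sum>\<^sub>\<infinity>i\<in>{1..}. \<phi> i * u i)"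
proof -
  have \<phi>: "0 \<le> \<phi> j" "\<phi> j \<le> R" "\<phi> (i + j) \<le> \<phi> i + \<phi> j" for i j
  proof -
    have "0 \<le> real i * h" "0 \<le> real j * h" using assms by auto
    then show "0 \<le> \<phi> j" "\<phi> j \<le> R" "\<phi> (i + j) \<le> \<phi> i + \<phi> j"
      using \<open>R > 0\<close> by (auto simp: \<phi>_def min_def algebra_simps)
  qed
  have fm': "finite_moment h p u" if "p \<le> \<delta>" for p
    using finite_moment_lower(1)[OF \<open>h > 0\<close> that nn fm] by simp
  define C where "C = (\<lambda>i. \<phi> i * coag_op h (\<alpha> 1) (\<beta> 1) u i)"
  define F where "F n = (\<lambda>i. \<phi> i * frag_op h (\<alpha> n) (\<beta> n) u i)" for n
  define V where "V = (\<lambda>i. \<phi> i * V_op h \<delta> u i)"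
  have C: "C summable_on {1..}" "infsum C {1..} \<le> 0"
    unfolding C_def using infsum_coag_op_nonpos[OF \<open>h > 0\<close> _ nn _ _ \<phi>, where a = "\<alpha> 1" and b = "\<beta> 1"] ab[of 1] fm'
    by auto
  have F: "F n summable_on {1..}"
    "infsum (F n) {1..} \<le> R powr (\<alpha> n + \<beta> n - \<delta>) * moment h (\<alpha> n) u * infsum V {1..}"
    if "n \<in> {2, 3}" for n
    using infsum_frag_op_le[OF \<open>h > 0\<close> \<open>R > 0\<close> _ _ nn, where a = "\<alpha> n" and b = "\<beta> n" and \<delta> = \<delta>] ab[of n] fm'[of \<delta>] fm'[of "\<alpha> n"] that
    unfolding F_def V_def \<phi>_def by auto
  have V0: "0 \<le> V i" if "i \<in> {1..}" for i
    using that nn \<phi> by (simp add: V_def V_op_def)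
  have V: "V summable_on {1..}"
  proof (rule summable_on_comparison_test[OF _ _ V0])
    show "(\<lambda>i. R * (u i * (real i * h) powr \<delta>)) summable_on {1..}"
      using fm by (intro summable_on_cmult_right) (simp add: finite_moment_def)
    show "V i \<le> R * (u i * (real i * h) powr \<delta>)" if "i \<in> {1..}" for i
      using that nn \<phi> by (auto simp: V_def V_op_def mult.commute[of "u i"] intro!: mult_right_mono)
  qed
  have "infsum (\<lambda>i. h powr \<delta> * (\<phi> i * u i)) {1..} \<le> infsum V {1..}"
  proof -
    have le: "h powr \<delta> * (\<phi> i * u i) \<le> V i" if "i \<in> {1..}" for i
    proof -
      have "h powr \<delta> \<le> (real i * h) powr \<delta>"
        using that assms by (intro powr_mono2) auto
      then have "h powr \<delta> * (\<phi> i * u i) \<le> (real i * h) powr \<delta> * (\<phi> i * u i)"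
        using nn \<phi> that by (intro mult_right_mono) auto
      then show ?thesis by (simp add: V_def V_op_def mult.left_commute)
    qed
    have "(\<lambda>i. h powr \<delta> * (\<phi> i * u i)) summable_on {1..}"
      by (rule summable_on_comparison_test[OF V le]) (use nn \<phi> in auto)
    then show ?thesis using V le by (rule infsum_mono)
  qed
  then have hV: "h powr \<delta> * infsum (\<lambda>i. \<phi> i * u i) {1..} \<le> infsum V {1..}"
    by (simp add: infsum_cmult_right')
  have "(\<Sum>\<^sub>\<infinity>i\<in>{1..}. \<phi> i * O_op h \<alpha> \<beta> \<delta> u i) = (\<Sum>\<^sub>\<infinity>i\<in>{1..}. C i + F 2 i + F 3 i - V i)"
    by (intro infsum_cong) (simp add: O_op_def S_op_def C_def F_def V_def algebra_simps)
  also have "\<dots> = infsum C {1..} + infsum (F 2) {1..} + infsum (F 3) {1..} - infsum V {1..}"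
    using C F V by (intro infsumI has_sum_diff_real has_sum_add has_sum_infsum) auto
  also have "\<dots> \<le> (\<Sum>n\<in>{2, 3}. R powr (\<alpha> n + \<beta> n - \<delta>) * moment h (\<alpha> n) u) * infsum V {1..} - infsum V {1..}"
    using C(2) F(2)[of 2] F(2)[of 3] by (simp add: algebra_simps)
  also have "\<dots> \<le> \<epsilon> * infsum V {1..} - infsum V {1..}"
    using \<epsilon>(1) infsum_nonneg[of "{1..}" V] V0 by (intro diff_right_mono mult_right_mono) auto
  \<comment> \<open>The lower bound on the dissipation is multiplied by
    \<open>1 - \<epsilon>\<close>, which is nonnegative.\<close>
  also have "\<dots> \<le> - ((1 - \<epsilon>) * h powr \<delta>) * infsum (\<lambda>i. \<phi> i * u i) {1..}"
    using mult_left_mono[OF hV, of "1 - \<epsilon>"] \<epsilon>(2) by (simp add: algebra_simps)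
  finally show ?thesis .
qed

section \<open>Time derivative of weighted sums and exponential decay\<close>

text \<open>Bounded weights pair continuously with \<open>ell1\<close>, so the norm derivative of
  the solution passes through the sum.\<close>

lemma bounded_linear_weighted_sum:
  assumes "\<And>i. \<bar>\<phi> i\<bar> \<le> (R::real)"
  shows "bounded_linear (\<lambda>u. \<Sum>\<^sub>\<infinity>i\<in>{1..}. \<phi> i * ell1_nth u i)"
proof (rule bounded_linear_intro[where K = R])
  have abs: "(\<lambda>i. \<bar>ell1_nth u i\<bar>) summable_on {1..}" for u
    using ell1_nth[of u] by simp
  have le: "\<bar>\<phi> i * ell1_nth u i\<bar> \<le> R * \<bar>ell1_nth u i\<bar>" for u i
    using assms[of i] by (simp add: abs_mult mult_right_mono)
  have s': "(\<lambda>i. \<bar>\<phi> i * ell1_nth u i\<bar>) summable_on {1..}" for u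
    by (rule summable_on_comparison_test[OF summable_on_cmult_right[OF abs[of u], of R] le]) auto
  have s: "(\<lambda>i. \<phi> i * ell1_nth u i) summable_on {1..}" for u
    by (rule abs_summable_summable) (use s'[of u] in simp)
  show "(\<Sum>\<^sub>\<infinity>i\<in>{1..}. \<phi> i * ell1_nth (u + v) i)
      = (\<Sum>\<^sub>\<infinity>i\<in>{1..}. \<phi> i * ell1_nth u i) + (\<Sum>\<^sub>\<infinity>i\<in>{1..}. \<phi> i * ell1_nth v i)" for u v
    unfolding infsum_add[OF s s, symmetric] by (simp add: plus_ell1.rep_eq distrib_left)
  show "(\<Sum>\<^sub>\<infinity>i\<in>{1..}. \<phi> i * ell1_nth (c *\<^sub>R u) i)
      = c *\<^sub>R (\<Sum>\<^sub>\<infinity>i\<in>{1..}. \<phi> i * ell1_nth u i)" for c u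
    by (simp add: scaleR_ell1.rep_eq mult.left_commute[of _ c] infsum_cmult_right')
  show "norm (\<Sum>\<^sub>\<infinity>i\<in>{1..}. \<phi> i * ell1_nth u i) \<le> norm u * R" for u
  proof -
    have "norm (\<Sum>\<^sub>\<infinity>i\<in>{1..}. \<phi> i * ell1_nth u i) \<le> (\<Sum>\<^sub>\<infinity>i\<in>{1..}. \<bar>\<phi> i * ell1_nth u i\<bar>)"
      using norm_infsum_bound[of "\<lambda>i. \<phi> i * ell1_nth u i"] s'[of u] by simp
    also have "\<dots> \<le> (\<Sum>\<^sub>\<infinity>i\<in>{1..}. R * \<bar>ell1_nth u i\<bar>)"
      using s' summable_on_cmult_right[OF abs[of u], of R] le by (rule infsum_mono)
    finally show ?thesis
      by (simp add: infsum_cmult_right' norm_ell1.rep_eq mult.commute)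
  qed
qed

text \<open>With the integrating factor \<open>exp (c * s)\<close> the function \<open>E\<close> has
  nonpositive derivative. Interior points suffice, given continuity up to 0.\<close>

lemma exp_decay_of_derivative_le:
  fixes M M' :: "real \<Rightarrow> real"
  assumes deriv: "\<And>t. t \<ge> 0 \<Longrightarrow> (M has_real_derivative M' t) (at t within {0..})"
    and le: "\<And>t. t \<ge> 0 \<Longrightarrow> M' t \<le> - c * M t" and "t \<ge> 0"
  shows "M t \<le> exp (- c * t) * M 0"
proof -
  define E where "E s = exp (c * s) * M s" for s
  have E: "(E has_real_derivative exp (c * s) * (c * M s + M' s)) (at s within {0..})" if "s \<ge> 0" for s
    unfolding E_def by (auto intro!: derivative_eq_intros deriv that simp: algebra_simps)
  have "E t \<le> E 0"
  proof (rule DERIV_nonpos_imp_decreasing_open[OF \<open>t \<ge> 0\<close>])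
    show "continuous_on {0..t} E"
      by (rule continuous_on_subset[of "{0..}"], rule DERIV_continuous_on[OF E]) auto
    fix s :: real assume "0 < s" "s < t"
    moreover have "at s within {0..} = at s"
      using \<open>0 < s\<close> by (intro at_within_interior) simp
    ultimately show "\<exists>y. DERIV E s :> y \<and> y \<le> 0"
      using E[of s] le[of s] by (intro exI[of _ "exp (c * s) * (c * M s + M' s)"]) (auto simp: mult_nonneg_nonpos)
  qed
  then have "exp (- c * t) * E t \<le> exp (- c * t) * E 0"
    by (rule mult_left_mono) simp
  then show ?thesis
    by (simp add: E_def exp_minus field_simps)
qed

section \<open>Decay of the truncated moments and removal of the truncation\<close>

theorem theorem2p6:
  fixes h \<delta> \<kappa> t :: real and \<alpha> \<beta> :: "nat \<Rightarrow> real"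
    and f0 :: "nat \<Rightarrow> real" and f :: "real \<Rightarrow> ell1"
  assumes "h > 0"
    and "\<forall>n\<in>{1,2,3}. \<alpha> n > 0 \<and> \<beta> n > 0" and "\<delta> > 0"
    and "\<delta> > (MAX n\<in>{1,2,3}. \<alpha> n + \<beta> n)"
    and "\<delta> > 2 * \<alpha> 1 + \<beta> 1 - 1"
    and "\<kappa> > Max {\<delta>, 1, 2 - \<alpha> 1 - \<beta> 1}"
    and "\<forall>i\<ge>1. f0 i \<ge> 0"
    and "finite_moment h \<kappa> f0"
    and "is_solution h \<alpha> \<beta> \<delta> \<kappa> f0 f"
    and "t \<ge> 0"
  shows "moment h 1 (ell1_nth (f t)) \<le> exp (- (h powr \<delta>) * t) * moment h 1 f0"
proof -
  define u where "u s = ell1_nth (f s)" for s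
  define B where "B = max (moment h \<kappa> f0) (2 * B_bound (\<alpha> 1) (\<beta> 1) \<delta> \<kappa> (moment h 1 f0))"
  obtain g where "\<forall>s\<ge>0. (f has_vector_derivative g s) (at s within {0..}) \<and>
      (\<forall>i\<ge>1. ell1_nth (g s) i = O_op h \<alpha> \<beta> \<delta> (ell1_nth (f s)) i)"
    using assms(9) unfolding is_solution_def by (elim conjE exE) (rule that)
  then have g: "\<And>s. s \<ge> 0 \<Longrightarrow> (f has_vector_derivative g s) (at s within {0..})"
      "\<And>s i. s \<ge> 0 \<Longrightarrow> i \<ge> 1 \<Longrightarrow> ell1_nth (g s) i = O_op h \<alpha> \<beta> \<delta> (u s) i"
    unfolding u_def by simp_all
  have u: "0 \<le> u s i" "finite_moment h 1 (u s)" "finite_moment h \<kappa> (u s)" "moment h \<kappa> (u s) \<le> B"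
    if "s \<ge> 0" "i \<ge> 1" for s i
    using assms(9) that by (auto simp: is_solution_def u_def B_def)
  have u0: "u 0 i = f0 i" if "i \<ge> 1" for i
    using assms(9) that by (auto simp: is_solution_def u_def)
  have ab: "0 < \<alpha> n \<and> 0 < \<beta> n \<and> \<alpha> n + \<beta> n < \<delta>" if "n \<in> {1, 2, 3}" for n
    using assms(2,4) that by auto
  have "\<delta> < \<kappa>" using assms(6) by simp
  define L where "L R v = (\<Sum>\<^sub>\<infinity>i\<in>{1..}. min (real i * h) R * ell1_nth v i)" for R v
  \<comment> \<open>Each moment of order \<open>\<alpha> n\<close> is replaced by its bound through
    the moment of order \<open>\<kappa>\<close>, which is at most \<open>B\<close> at all times.
    This makes the decay rate constant in time.\<close>
  define \<epsilon> where "\<epsilon> R = (\<Sum>n\<in>{2, 3}. R powr (\<alpha> n + \<beta> n - \<delta>) * (h powr (\<alpha> n - \<kappa>) * B))" for R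
  have decay: "L R (f t) \<le> exp (- ((1 - \<epsilon> R) * h powr \<delta>) * t) * L R (f 0)"
    if R: "R > 0" "\<epsilon> R \<le> 1" for R
  proof (rule exp_decay_of_derivative_le[OF _ _ \<open>t \<ge> 0\<close>])
    fix s :: real assume s: "s \<ge> 0"
    have "bounded_linear (L R)"
      unfolding L_def using \<open>h > 0\<close> R by (intro bounded_linear_weighted_sum[where R = R]) auto
    from bounded_linear.has_vector_derivative[OF this g(1)[OF s]]
    show "((\<lambda>s. L R (f s)) has_real_derivative L R (g s)) (at s within {0..})"
      by (simp add: has_real_derivative_iff_has_vector_derivative)
    have nn: "\<And>i. i \<ge> 1 \<Longrightarrow> 0 \<le> u s i" using u(1) s by simp
    have fm: "finite_moment h \<delta> (u s)"
      using finite_moment_lower(1)[OF \<open>h > 0\<close> _ nn u(3)[OF s order.refl], of \<delta>] \<open>\<delta> < \<kappa>\<close> by simp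
    have "(\<Sum>n\<in>{2, 3}. R powr (\<alpha> n + \<beta> n - \<delta>) * moment h (\<alpha> n) (u s)) \<le> \<epsilon> R"
      unfolding \<epsilon>_def
    proof (intro sum_mono mult_left_mono)
      fix n :: nat assume "n \<in> {2, 3}"
      then have "\<alpha> n \<le> \<kappa>" using ab[of n] \<open>\<delta> < \<kappa>\<close> by auto
      then have "moment h (\<alpha> n) (u s) \<le> h powr (\<alpha> n - \<kappa>) * moment h \<kappa> (u s)"
        using finite_moment_lower(2)[OF \<open>h > 0\<close> _ nn u(3)[OF s order.refl]] by simp
      also have "\<dots> \<le> h powr (\<alpha> n - \<kappa>) * B"
        using u(4)[OF s order.refl] by (intro mult_left_mono) auto
      finally show "moment h (\<alpha> n) (u s) \<le> h powr (\<alpha> n - \<kappa>) * B" .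
    qed auto
    from infsum_truncated_O_op_le[OF \<open>h > 0\<close> R(1) _ _ nn fm this R(2)]
    have "(\<Sum>\<^sub>\<infinity>i\<in>{1..}. min (real i * h) R * O_op h \<alpha> \<beta> \<delta> (u s) i)
        \<le> - ((1 - \<epsilon> R) * h powr \<delta>) * (\<Sum>\<^sub>\<infinity>i\<in>{1..}. min (real i * h) R * u s i)"
      using \<open>\<delta> > 0\<close> ab by (simp add: less_imp_le)
    moreover have "L R (g s) = (\<Sum>\<^sub>\<infinity>i\<in>{1..}. min (real i * h) R * O_op h \<alpha> \<beta> \<delta> (u s) i)"
      unfolding L_def using g(2)[OF s] by (intro infsum_cong) auto
    ultimately show "L R (g s) \<le> - ((1 - \<epsilon> R) * h powr \<delta>) * L R (f s)"
      by (simp only: L_def u_def)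
  qed
  have summ: "(\<lambda>i. u s i * (real i * h)) summable_on {1..}"
    and mom: "moment h 1 (u s) = (\<Sum>\<^sub>\<infinity>i\<in>{1..}. u s i * (real i * h))" if "s \<ge> 0" for s
  proof -
    have eq: "u s i * (real i * h) powr 1 = u s i * (real i * h)" for i
      using \<open>h > 0\<close> by simp
    show "(\<lambda>i. u s i * (real i * h)) summable_on {1..}"
      using u(2)[OF that order.refl] unfolding finite_moment_def eq .
    show "moment h 1 (u s) = (\<Sum>\<^sub>\<infinity>i\<in>{1..}. u s i * (real i * h))"
      unfolding moment_def eq ..
  qed
  have trunc: "(\<lambda>i. min (real i * h) R * u s i) summable_on {1..}"
     and L_le: "L R (f s) \<le> moment h 1 (u s)" if "s \<ge> 0" "R > 0" for R s
  proof -
    have le: "min (real i * h) R * u s i \<le> u s i * (real i * h)" if "i \<in> {1..}" for i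
      using that u(1)[OF \<open>s \<ge> 0\<close>, of i] by (subst mult.commute) (auto intro!: mult_left_mono)
    show *: "(\<lambda>i. min (real i * h) R * u s i) summable_on {1..}"
      by (rule summable_on_comparison_test[OF summ le]) (use u(1) that \<open>h > 0\<close> in auto)
    show "L R (f s) \<le> moment h 1 (u s)"
      unfolding mom[OF \<open>s \<ge> 0\<close>] L_def u_def[symmetric] using * summ[OF \<open>s \<ge> 0\<close>] le by (rule infsum_mono)
  qed
  have m0: "moment h 1 (u 0) = moment h 1 f0"
    unfolding moment_def using u0 by (intro infsum_cong) auto
  \<comment> \<open>The strict inequality \<open>\<alpha> n + \<beta> n < \<delta>\<close> makes the
    exponents of \<open>R\<close> negative.\<close>
  have \<epsilon>_lim: "(\<epsilon> \<longlongrightarrow> 0) at_top"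
  proof -
    have "((\<lambda>R. R powr (\<alpha> n + \<beta> n - \<delta>)) \<longlongrightarrow> 0) at_top" if "n \<in> {2, 3}" for n
      using ab[of n] that by (intro tendsto_neg_powr filterlim_ident) auto
    then show ?thesis
      unfolding \<epsilon>_def by (intro tendsto_null_sum tendsto_mult_left_zero) auto
  qed
  \<comment> \<open>It suffices to bound finite partial sums: on a finite set \<open>A\<close> the
    truncation is inactive for large \<open>R\<close>, so the left-hand side no longer depends on
    \<open>R\<close> while the right-hand side converges.\<close>
  have "infsum (\<lambda>i. u t i * (real i * h)) {1..} \<le> exp (- (h powr \<delta>) * t) * moment h 1 f0"
  proof (rule infsum_le_finite_sums[OF summ[OF \<open>t \<ge> 0\<close>]])
    fix A :: "nat set" assume A: "finite A" "A \<subseteq> {1..}"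
    have "((\<lambda>R. exp (- ((1 - \<epsilon> R) * h powr \<delta>) * t) * moment h 1 f0)
        \<longlongrightarrow> exp (- ((1 - 0) * h powr \<delta>) * t) * moment h 1 f0) at_top"
      by (intro tendsto_intros \<epsilon>_lim)
    moreover have "\<forall>\<^sub>F R in at_top. (\<Sum>i\<in>A. u t i * (real i * h))
        \<le> exp (- ((1 - \<epsilon> R) * h powr \<delta>) * t) * moment h 1 f0"
    proof -
      have "\<forall>\<^sub>F R in at_top. \<epsilon> R < 1"
        using order_tendstoD(2)[OF \<epsilon>_lim, of 1] by simp
      moreover have "\<forall>\<^sub>F R in at_top. \<forall>i\<in>A. real i * h \<le> R"
        using A by (intro eventually_ball_finite ballI eventually_ge_at_top) auto
      ultimately show ?thesis
        using eventually_gt_at_top[of 0]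
      proof eventually_elim
        case (elim R)
        have "(\<Sum>i\<in>A. u t i * (real i * h)) = (\<Sum>i\<in>A. min (real i * h) R * u t i)"
          using elim(2) by (intro sum.cong) auto
        also have "\<dots> \<le> L R (f t)"
          unfolding L_def u_def[symmetric] using A trunc[OF \<open>t \<ge> 0\<close>] elim u(1)[OF \<open>t \<ge> 0\<close>] \<open>h > 0\<close>
          by (intro finite_sum_le_infsum) auto
        also have "\<dots> \<le> exp (- ((1 - \<epsilon> R) * h powr \<delta>) * t) * L R (f 0)"
          using elim by (intro decay) auto
        also have "\<dots> \<le> exp (- ((1 - \<epsilon> R) * h powr \<delta>) * t) * moment h 1 f0"
          using L_le[of 0 R] elim m0 by (intro mult_left_mono) auto
        finally show ?case .
      qed
    qed
    ultimately have "(\<Sum>i\<in>A. u t i * (real i * h)) \<le> exp (- ((1 - 0) * h powr \<delta>) * t) * moment h 1 f0"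
      by (rule tendsto_lowerbound) simp
    then show "(\<Sum>i\<in>A. u t i * (real i * h)) \<le> exp (- (h powr \<delta>) * t) * moment h 1 f0"
      by simp
  qed
  then show ?thesis
    using mom[OF \<open>t \<ge> 0\<close>] by (simp add: u_def)
qed

end
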